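(* There is a category isomorphism between the category of de Barros semigroups and the category of Ehresmann-ordered categories satisfying the following condition (OC4): for all elements $a,b$ of the category, if $a\leq b$, $D(a)=D(b)$ and $R(a)=R(b)$, then $a=b$.
   Context: An Ehresmann semigroup is a semigroup $(S,\cdot)$ with unary operations $D,R$ such that for all $s,t\in S$: $D(s)s=s$, $sR(s)=s$; $D(R(s))=R(s)$, $R(D(s))=D(s)$; $D(st)=D(sD(t))$, $R(st)=R(R(s)t)$; $D(D(s)D(t))=D(s)D(t)$; $D(s)D(t)=D(t)D(s)$. On an Ehresmann semigroup define partial orders: $s\leq_l t$ iff $s=D(s)t$; $s\leq_r t$ iff $s=tR(s)$. These permute as relations, and $\leq_e$ denotes their join, $\leq_e\,=\,\leq_l\circ\leq_r\,=\,\leq_r\circ\leq_l$, which is a partial order. An Ehresmann semigroup is de Barros if $\leq_e$ is compatible with multiplication: $a\leq_e b$ and $c\leq_e d$ imply $ac\leq_e bd$. The arrows of the category of de Barros semigroups are the Ehresmann semigroup homomorphisms: semigroup homomorphisms $F:S\to T$ with $D(s)F=D(sF)$ and $R(s)F=R(sF)$ for all $s\in S$. (Functions are written on the right.) A (small) category is a partial algebra $(C,\circ,D,R)$ with $\circ$ a partial binary operation and $D,R$ unary operations such that for all $x,y,z\in C$: $D(x)\circ x=x=x\circ R(x)$; $D(R(x))=R(x)$, $R(D(x))=D(x)$; $x\circ y$ is defined iff $R(x)=D(y)$; if $x\circ y$ is defined then $D(x\circ y)=D(x)$ and $R(x\circ y)=R(y)$; if $(x\circ y)\circ z$ and $x\circ(y\circ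 z)$ are defined they are equal. $D(C)=\{D(x)\mid x\in C\}=R(C)$ is the set of identities. An $\Omega$-structured category $(C,\circ,D,R,\leq)$ is a category with a partial order $\leq$ on $C$ such that $a\leq b$ implies $D(a)\leq D(b)$ and $R(a)\leq R(b)$; and if $a\leq b$, $c\leq d$ and both $a\circ c$, $b\circ d$ exist, then $a\circ c\leq b\circ d$. An Ehresmann-ordered category is an $\Omega$-structured category $(C,\circ,D,R,\leq)$ such that: (OC6) for all $x\in C$ and $e\in D(C)$ with $e\leq D(x)$, there is a greatest element $e|x=\max\{y\leq x\mid D(y)\leq e\}$, and $D(e|x)=e$; and for all $x\in C$ and $e\in D(C)$ with $e\leq R(x)$, there is a greatest element $x|e=\max\{y\leq x\mid R(y)\leq e\}$, and $R(x|e)=e$; (OC7') if $a\leq b\circ c$, then there are $b'\leq b$, $c'\leq c$ such that $D(a)=D(b')$, $R(a)=R(c')$, $b'\circ c'$ exists, and $a\leq b'\circ c'$; (OCI) if $a\in C$ and $a\leq e\in D(C)$, then $a\in D(C)$; and $(D(C),\leq)$ is a meet-semilattice (with meet $\wedge$). The arrows between Ehresmann-ordered categories are the functors $F:C_1\to C_2$ (maps preserving $D$, $R$ and all existing products $\circ$) such that: $s\leq t$ implies $sF\leq tF$; $(e\wedge f)F=eF\wedge fF$ for $e,f\in D(C_1)$; if $s\in C_1$, $e\in D(C_1)$ and $e\leq D(s)$ then $(e|s)F=(eF)|(sF)$, and dually if $f\in D(C_1)$ and $f\leq R(s)$ then $(s|f)F=(sF)|(fF)$. *)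

theory Defs
  imports Main "HOL-Library.FuncSet"
begin

text \<open>
  All structures below live on a carrier set inside a type. So that structures which agree on their
  carriers are equal (as an isomorphism of categories requires), operations
  are extensional: they take the value \<^const>\<open>undefined\<close> (or \<^const>\<open>None\<close>, for partial operations)
  outside the carrier. Carriers may be empty.
\<close>

section \<open>Small categories as partial algebras\<close>

record 'a category_struct =
  arrows :: "'a set"
  cmp :: "'a \<Rightarrow> 'a \<Rightarrow> 'a option"
  src :: "'a \<Rightarrow> 'a"  ("\<^bold>D\<index>")
  trg :: "'a \<Rightarrow> 'a"  ("\<^bold>R\<index>")

text \<open>\<open>cmp C x y = Some z\<close> means that \<open>x \<circ> y\<close> is defined and equals \<open>z\<close>.
  Arrows are composed from left to right.\<close>

locale small_category =
  fixes C :: "('a, 'm) category_struct_scheme" (structure)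
  assumes src_closed: "\<^bold>D \<in> arrows C \<rightarrow>\<^sub>E arrows C"
    and trg_closed: "\<^bold>R \<in> arrows C \<rightarrow>\<^sub>E arrows C"
    and cmp_closed: "cmp C x y = Some z \<Longrightarrow> x \<in> arrows C \<and> y \<in> arrows C \<and> z \<in> arrows C"
    and src_cmp: "x \<in> arrows C \<Longrightarrow> cmp C (\<^bold>D x) x = Some x"
    and cmp_trg: "x \<in> arrows C \<Longrightarrow> cmp C x (\<^bold>R x) = Some x"
    and src_trg: "x \<in> arrows C \<Longrightarrow> \<^bold>D (\<^bold>R x) = \<^bold>R x"
    and trg_src: "x \<in> arrows C \<Longrightarrow> \<^bold>R (\<^bold>D x) = \<^bold>D x"
    and cmp_defined_iff:
      "x \<in> arrows C \<Longrightarrow> y \<in> arrows C \<Longrightarrow> cmp C x y \<noteq> None \<longleftrightarrow> \<^bold>R x = \<^bold>D y"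
    and src_of_cmp: "cmp C x y = Some z \<Longrightarrow> \<^bold>D z = \<^bold>D x"
    and trg_of_cmp: "cmp C x y = Some z \<Longrightarrow> \<^bold>R z = \<^bold>R y"
    and cmp_assoc:
      "cmp C x y = Some xy \<Longrightarrow> cmp C xy z = Some u \<Longrightarrow>
       cmp C y z = Some yz \<Longrightarrow> cmp C x yz = Some v \<Longrightarrow> u = v"

definition identities :: "('a, 'm) category_struct_scheme \<Rightarrow> 'a set" where
  "identities C = src C ` arrows C"

definition is_functor ::
  "('a, 'm) category_struct_scheme \<Rightarrow> ('b, 'n) category_struct_scheme \<Rightarrow> ('a \<Rightarrow> 'b) \<Rightarrow> bool" where
  "is_functor A B F \<longleftrightarrow>
     F \<in> arrows A \<rightarrow> arrows B \<and>
     (\<forall>x\<in>arrows A. F (src A x) = src B (F x) \<and> F (trg A x) = trg B (F x)) \<and>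
     (\<forall>x y z. cmp A x y = Some z \<longrightarrow> cmp B (F x) (F y) = Some (F z))"

definition category_isomorphism ::
  "('a, 'm) category_struct_scheme \<Rightarrow> ('b, 'n) category_struct_scheme \<Rightarrow> ('a \<Rightarrow> 'b) \<Rightarrow> bool" where
  "category_isomorphism A B F \<longleftrightarrow>
     small_category A \<and> small_category B \<and> is_functor A B F \<and>
     (\<exists>G. is_functor B A G \<and> (\<forall>x\<in>arrows A. G (F x) = x) \<and> (\<forall>y\<in>arrows B. F (G y) = y))"

text \<open>The category with objects \<open>Ob\<close>, where \<open>Hom S T\<close> consists of extensional functions on the
  underlying set \<open>U S\<close>. An arrow is such a function together with its domain and
  codomain; an object \<open>S\<close> is represented by its identity arrow.\<close>

definition concrete_category ::
  "'o set \<Rightarrow> ('o \<Rightarrow> 'a set) \<Rightarrow> ('o \<Rightarrow> 'o \<Rightarrow> ('a \<Rightarrow> 'a) set) \<Rightarrow>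
   ('o \<times> ('a \<Rightarrow> 'a) \<times> 'o) category_struct" where
  "concrete_category Ob U Hom =
    (let Ar = {(S, f, T). S \<in> Ob \<and> T \<in> Ob \<and> f \<in> Hom S T} in
     \<lparr> arrows = Ar,
       cmp = (\<lambda>(S, f, T) (S', g, T').
         if (S, f, T) \<in> Ar \<and> (S', g, T') \<in> Ar \<and> T = S' then Some (S, compose (U S) g f, T') else None),
       src = (\<lambda>(S, f, T)\<in>Ar. (S, \<lambda>x\<in>U S. x, S)),
       trg = (\<lambda>(S, f, T)\<in>Ar. (T, \<lambda>x\<in>U T. x, T)) \<rparr>)"


section \<open>Ehresmann and de Barros semigroups\<close>

record 'a biunary_semigroup =
  elems :: "'a set"
  mul :: "'a \<Rightarrow> 'a \<Rightarrow> 'a"  (infixl "\<cdot>\<index>" 70)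
  dm :: "'a \<Rightarrow> 'a"  ("\<D>\<index>")
  rg :: "'a \<Rightarrow> 'a"  ("\<R>\<index>")

locale ehresmann_semigroup =
  fixes S :: "'a biunary_semigroup" (structure)
  assumes mul_closed: "(\<cdot>) \<in> elems S \<rightarrow>\<^sub>E elems S \<rightarrow>\<^sub>E elems S"
    and D_closed: "\<D> \<in> elems S \<rightarrow>\<^sub>E elems S"
    and R_closed: "\<R> \<in> elems S \<rightarrow>\<^sub>E elems S"
    and mul_assoc:
      "s \<in> elems S \<Longrightarrow> t \<in> elems S \<Longrightarrow> u \<in> elems S \<Longrightarrow> (s \<cdot> t) \<cdot> u = s \<cdot> (t \<cdot> u)"
    and D_mul: "s \<in> elems S \<Longrightarrow> \<D> s \<cdot> s = s"
    and mul_R: "s \<in> elems S \<Longrightarrow> s \<cdot> \<R> s = s"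
    and D_R: "s \<in> elems S \<Longrightarrow> \<D> (\<R> s) = \<R> s"
    and R_D: "s \<in> elems S \<Longrightarrow> \<R> (\<D> s) = \<D> s"
    and D_of_mul: "s \<in> elems S \<Longrightarrow> t \<in> elems S \<Longrightarrow> \<D> (s \<cdot> t) = \<D> (s \<cdot> \<D> t)"
    and R_of_mul: "s \<in> elems S \<Longrightarrow> t \<in> elems S \<Longrightarrow> \<R> (s \<cdot> t) = \<R> (\<R> s \<cdot> t)"
    and D_D_mul_D: "s \<in> elems S \<Longrightarrow> t \<in> elems S \<Longrightarrow> \<D> (\<D> s \<cdot> \<D> t) = \<D> s \<cdot> \<D> t"
    and D_mul_D_commute: "s \<in> elems S \<Longrightarrow> t \<in> elems S \<Longrightarrow> \<D> s \<cdot> \<D> t = \<D> t \<cdot> \<D> s"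

definition le_l :: "'a biunary_semigroup \<Rightarrow> 'a rel" where
  "le_l S = {(s, t). s \<in> elems S \<and> t \<in> elems S \<and> s = mul S (dm S s) t}"

definition le_r :: "'a biunary_semigroup \<Rightarrow> 'a rel" where
  "le_r S = {(s, t). s \<in> elems S \<and> t \<in> elems S \<and> s = mul S t (rg S s)}"

definition le_e :: "'a biunary_semigroup \<Rightarrow> 'a rel" where
  "le_e S = le_l S O le_r S"

locale de_Barros_semigroup = ehresmann_semigroup +
  assumes le_e_mul: "(a, b) \<in> le_e S \<Longrightarrow> (c, d) \<in> le_e S \<Longrightarrow> (a \<cdot> c, b \<cdot> d) \<in> le_e S"

definition ehresmann_hom ::
  "'a biunary_semigroup \<Rightarrow> 'b biunary_semigroup \<Rightarrow> ('a \<Rightarrow> 'b) set" where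
  "ehresmann_hom S T = {F \<in> elems S \<rightarrow>\<^sub>E elems T.
     (\<forall>s\<in>elems S. \<forall>t\<in>elems S. F (s \<cdot>\<^bsub>S\<^esub> t) = F s \<cdot>\<^bsub>T\<^esub> F t) \<and>
     (\<forall>s\<in>elems S. F (\<D>\<^bsub>S\<^esub> s) = \<D>\<^bsub>T\<^esub> (F s) \<and> F (\<R>\<^bsub>S\<^esub> s) = \<R>\<^bsub>T\<^esub> (F s))}"

definition de_Barros_category ::
  "('a biunary_semigroup \<times> ('a \<Rightarrow> 'a) \<times> 'a biunary_semigroup) category_struct" where
  "de_Barros_category = concrete_category {S. de_Barros_semigroup S} elems ehresmann_hom"


section \<open>Ehresmann-ordered categories\<close>

record 'a ordered_category_struct = "'a category_struct" +
  ord :: "'a rel"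

abbreviation ord_le :: "('a, 'm) ordered_category_struct_scheme \<Rightarrow> 'a \<Rightarrow> 'a \<Rightarrow> bool"
  ("(_ \<sqsubseteq>\<index> _)" [51, 51] 50) where
  "x \<sqsubseteq>\<^bsub>C\<^esub> y \<equiv> (x, y) \<in> ord C"

locale omega_structured_category = small_category C
  for C :: "'a ordered_category_struct" (structure) +
  assumes partial_order: "partial_order_on (arrows C) (ord C)"
    and src_mono: "a \<sqsubseteq> b \<Longrightarrow> \<^bold>D a \<sqsubseteq> \<^bold>D b"
    and trg_mono: "a \<sqsubseteq> b \<Longrightarrow> \<^bold>R a \<sqsubseteq> \<^bold>R b"
    and cmp_mono:
      "a \<sqsubseteq> b \<Longrightarrow> c \<sqsubseteq> d \<Longrightarrow> cmp C a c = Some ac \<Longrightarrow> cmp C b d = Some bd \<Longrightarrow> ac \<sqsubseteq> bd"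

definition is_greatest :: "'a rel \<Rightarrow> 'a set \<Rightarrow> 'a \<Rightarrow> bool" where
  "is_greatest r A m \<longleftrightarrow> m \<in> A \<and> (\<forall>y\<in>A. (y, m) \<in> r)"

definition is_left_restriction :: "'a ordered_category_struct \<Rightarrow> 'a \<Rightarrow> 'a \<Rightarrow> 'a \<Rightarrow> bool" where
  "is_left_restriction C e x = is_greatest (ord C) {y. y \<sqsubseteq>\<^bsub>C\<^esub> x \<and> \<^bold>D\<^bsub>C\<^esub> y \<sqsubseteq>\<^bsub>C\<^esub> e}"

definition is_right_restriction :: "'a ordered_category_struct \<Rightarrow> 'a \<Rightarrow> 'a \<Rightarrow> 'a \<Rightarrow> bool" where
  "is_right_restriction C x e = is_greatest (ord C) {y. y \<sqsubseteq>\<^bsub>C\<^esub> x \<and> \<^bold>R\<^bsub>C\<^esub> y \<sqsubseteq>\<^bsub>C\<^esub> e}"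

definition is_meet :: "'a ordered_category_struct \<Rightarrow> 'a \<Rightarrow> 'a \<Rightarrow> 'a \<Rightarrow> bool" where
  "is_meet C e f = is_greatest (ord C) {g \<in> identities C. g \<sqsubseteq>\<^bsub>C\<^esub> e \<and> g \<sqsubseteq>\<^bsub>C\<^esub> f}"

text \<open>The elements \<open>e|x\<close>, \<open>x|e\<close> and \<open>e \<and> f\<close>, meaningful when they exist (they are then unique
  by antisymmetry).\<close>

definition left_restriction :: "'a ordered_category_struct \<Rightarrow> 'a \<Rightarrow> 'a \<Rightarrow> 'a" where
  "left_restriction C e x = (THE y. is_left_restriction C e x y)"

definition right_restriction :: "'a ordered_category_struct \<Rightarrow> 'a \<Rightarrow> 'a \<Rightarrow> 'a" where
  "right_restriction C x e = (THE y. is_right_restriction C x e y)"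

definition meet :: "'a ordered_category_struct \<Rightarrow> 'a \<Rightarrow> 'a \<Rightarrow> 'a" where
  "meet C e f = (THE m. is_meet C e f m)"

locale ehresmann_ordered_category = omega_structured_category +
  assumes OC6_left:
      "x \<in> arrows C \<Longrightarrow> e \<in> identities C \<Longrightarrow> e \<sqsubseteq> \<^bold>D x \<Longrightarrow>
       \<exists>y. is_left_restriction C e x y \<and> \<^bold>D y = e"
    and OC6_right:
      "x \<in> arrows C \<Longrightarrow> e \<in> identities C \<Longrightarrow> e \<sqsubseteq> \<^bold>R x \<Longrightarrow>
       \<exists>y. is_right_restriction C x e y \<and> \<^bold>R y = e"
    and OC7':
      "cmp C b c = Some bc \<Longrightarrow> a \<sqsubseteq> bc \<Longrightarrow>
       \<exists>b' c' bc'. b' \<sqsubseteq> b \<and> c' \<sqsubseteq> c \<and> \<^bold>D a = \<^bold>D b' \<and> \<^bold>R a = \<^bold>R c' \<and>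
         cmp C b' c' = Some bc' \<and> a \<sqsubseteq> bc'"
    and OCI: "a \<in> arrows C \<Longrightarrow> e \<in> identities C \<Longrightarrow> a \<sqsubseteq> e \<Longrightarrow> a \<in> identities C"
    and meet_exists: "e \<in> identities C \<Longrightarrow> f \<in> identities C \<Longrightarrow> \<exists>m. is_meet C e f m"

definition OC4 :: "'a ordered_category_struct \<Rightarrow> bool" where
  "OC4 C \<longleftrightarrow> (\<forall>a\<in>arrows C. \<forall>b\<in>arrows C.
     a \<sqsubseteq>\<^bsub>C\<^esub> b \<and> \<^bold>D\<^bsub>C\<^esub> a = \<^bold>D\<^bsub>C\<^esub> b \<and> \<^bold>R\<^bsub>C\<^esub> a = \<^bold>R\<^bsub>C\<^esub> b \<longrightarrow> a = b)"

definition ehresmann_ordered_functor ::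
  "'a ordered_category_struct \<Rightarrow> 'b ordered_category_struct \<Rightarrow> ('a \<Rightarrow> 'b) set" where
  "ehresmann_ordered_functor C1 C2 = {F. F \<in> extensional (arrows C1) \<and> is_functor C1 C2 F \<and>
     (\<forall>s t. s \<sqsubseteq>\<^bsub>C1\<^esub> t \<longrightarrow> F s \<sqsubseteq>\<^bsub>C2\<^esub> F t) \<and>
     (\<forall>e\<in>identities C1. \<forall>f\<in>identities C1. F (meet C1 e f) = meet C2 (F e) (F f)) \<and>
     (\<forall>s\<in>arrows C1. \<forall>e\<in>identities C1. e \<sqsubseteq>\<^bsub>C1\<^esub> \<^bold>D\<^bsub>C1\<^esub> s \<longrightarrow>
        F (left_restriction C1 e s) = left_restriction C2 (F e) (F s)) \<and>
     (\<forall>s\<in>arrows C1. \<forall>f\<in>identities C1. f \<sqsubseteq>\<^bsub>C1\<^esub> \<^bold>R\<^bsub>C1\<^esub> s \<longrightarrow>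
        F (right_restriction C1 s f) = right_restriction C2 (F s) (F f))}"

definition ehresmann_ordered_category_OC4 ::
  "('a ordered_category_struct \<times> ('a \<Rightarrow> 'a) \<times> 'a ordered_category_struct) category_struct" where
  "ehresmann_ordered_category_OC4 =
     concrete_category {C. ehresmann_ordered_category C \<and> OC4 C} arrows ehresmann_ordered_functor"

end

theory Submission
  imports Defs
begin

text \<open>
  A de Barros semigroup \<open>S\<close> becomes a category on the same set, with the same \<open>D\<close> and \<open>R\<close>, by
  remembering a product \<open>s \<cdot> t\<close> only when \<open>R(s) = D(t)\<close>; the order \<open>\<le>\<^sub>e\<close> is kept as additional
  structure. The order holds what the restricted product has lost: restrictions and meets in the
  category are products with projections, and
  \<open>s \<cdot> t = (s \<cdot> e) \<cdot> (e \<cdot> t)\<close> for \<open>e = R(s) \<cdot> D(t)\<close>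
  expresses an arbitrary product as a composite of restrictions. In an arbitrary
  Ehresmann-ordered category the same formula
  defines the pseudoproduct \<open>a \<otimes> b = (a|e) \<circ> (e|b)\<close> with \<open>e = R(a) \<and> D(b)\<close>.

  The pseudoproduct has an order-theoretic description: it is the greatest of
  all composites \<open>a' \<circ> b'\<close> with \<open>a' \<le> a\<close> and \<open>b' \<le> b\<close> (lemma \<open>pseudoproduct_greatest\<close>). Monotonicity
  of \<open>\<otimes>\<close> follows at once. For associativity, (OC7') and (OC4) together say that every
  element below \<open>b \<circ> c\<close> is itself a composite \<open>b' \<circ> c'\<close> with \<open>b' \<le> b\<close> and \<open>c' \<le> c\<close>, so
  both bracketings of \<open>a \<otimes> b \<otimes> c\<close> are the greatest of the triple composites \<open>a' \<circ> b' \<circ> c'\<close> of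
  elements below \<open>a\<close>, \<open>b\<close>, \<open>c\<close> (lemma \<open>pseudoproduct_assoc\<close>).

  The two constructions are mutually inverse on objects. That the order comes back is the
  equivalence of \<open>s \<le> t\<close> with \<open>s = D(s) \<otimes> t \<otimes> R(s)\<close> (lemma \<open>ord_iff_pseudoproduct\<close>): if
  \<open>s \<le> t\<close>, both sides have the same source and target and the left one lies below the right
  one, so (OC4) identifies them. In semigroups the relation \<open>\<le>\<^sub>e\<close> has the same description
  (lemma \<open>le_e_iff\<close>), which is why (OC4) holds in the category of a semigroup.

  Since order, meets and restrictions are all defined from the semigroup operations, and the
  product from composition, meets and restrictions, a map is a homomorphism of semigroups
  exactly when it is an arrow between the ordered categories (lemma
  \<open>ehresmann_ordered_functor_eq_hom\<close>). The functor can therefore leave functions unchanged.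
\<close>

section \<open>Isomorphisms of concrete categories\<close>

lemma small_category_concrete:
  assumes Hom_ext: "\<And>S T. S \<in> Ob \<Longrightarrow> T \<in> Ob \<Longrightarrow> Hom S T \<subseteq> U S \<rightarrow>\<^sub>E U T"
    and Hom_id: "\<And>S. S \<in> Ob \<Longrightarrow> (\<lambda>x\<in>U S. x) \<in> Hom S S"
    and Hom_comp: "\<And>S T V f g. S \<in> Ob \<Longrightarrow> T \<in> Ob \<Longrightarrow> V \<in> Ob \<Longrightarrow> f \<in> Hom S T \<Longrightarrow> g \<in> Hom T V
      \<Longrightarrow> compose (U S) g f \<in> Hom S V"
  shows "small_category (concrete_category Ob U Hom)"
proof -
  have unit_right: "compose (U S) (\<lambda>x\<in>U T. x) f = f"
    and unit_left: "compose (U S) f (\<lambda>x\<in>U S. x) = f"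
    if "S \<in> Ob" "T \<in> Ob" "f \<in> Hom S T" for S T f
  proof -
    have f: "f \<in> U S \<rightarrow>\<^sub>E U T" using Hom_ext that by blast
    then show "compose (U S) (\<lambda>x\<in>U T. x) f = f" by (intro Id_compose) (auto simp: PiE_def)
    show "compose (U S) f (\<lambda>x\<in>U S. x) = f" using f by (intro compose_Id) (auto simp: PiE_def)
  qed
  show ?thesis
    unfolding concrete_category_def Let_def
  proof (unfold_locales, goal_cases)
    \<comment> \<open>associativity of composition\<close>
    case (11 x y xy z u yz v)
    then obtain S f T g T' h T'' where
      "x = (S, f, T)" "y = (T, g, T')" "z = (T', h, T'')"
      "f \<in> Hom S T" "S \<in> Ob" "T \<in> Ob"
      and uv: "u = (S, compose (U S) h (compose (U S) g f), T'')"
        "v = (S, compose (U S) (compose (U T) h g) f, T'')"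
      by (auto split: if_splits prod.splits)
    then have "f \<in> U S \<rightarrow> U T" using Hom_ext by blast
    from compose_assoc[OF this] uv show ?case by simp
  qed (auto split: if_splits simp: Hom_id unit_left unit_right Hom_comp)
qed

text \<open>Two concrete categories over the same underlying sets differ only in the names of their
  objects once a bijection of objects preserves hom-sets; the functor renames the objects and leaves
  the underlying functions alone.\<close>

lemma concrete_category_isomorphism:
  assumes Hom_ext: "\<And>S T. S \<in> Ob \<Longrightarrow> T \<in> Ob \<Longrightarrow> Hom S T \<subseteq> U S \<rightarrow>\<^sub>E U T"
    and Hom_id: "\<And>S. S \<in> Ob \<Longrightarrow> (\<lambda>x\<in>U S. x) \<in> Hom S S"
    and Hom_comp: "\<And>S T V f g. S \<in> Ob \<Longrightarrow> T \<in> Ob \<Longrightarrow> V \<in> Ob \<Longrightarrow> f \<in> Hom S T \<Longrightarrow> g \<in> Hom T V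
      \<Longrightarrow> compose (U S) g f \<in> Hom S V"
    and bij: "bij_betw \<Phi> Ob Ob'"
    and U_eq: "\<And>S. S \<in> Ob \<Longrightarrow> U' (\<Phi> S) = U S"
    and Hom_eq: "\<And>S T. S \<in> Ob \<Longrightarrow> T \<in> Ob \<Longrightarrow> Hom' (\<Phi> S) (\<Phi> T) = Hom S T"
  shows "category_isomorphism (concrete_category Ob U Hom) (concrete_category Ob' U' Hom')
    (\<lambda>(S, f, T). (\<Phi> S, f, \<Phi> T))"
proof -
  define \<Psi> where "\<Psi> = inv_into Ob \<Phi>"
  have \<Phi>: "\<Phi> S \<in> Ob'" "\<Psi> (\<Phi> S) = S" if "S \<in> Ob" for S
    using that bij unfolding \<Psi>_def by (auto simp: bij_betw_def)
  have \<Psi>: "\<Psi> S \<in> Ob" "\<Phi> (\<Psi> S) = S" if "S \<in> Ob'" for S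
    using that bij unfolding \<Psi>_def
    by (auto simp: bij_betw_def f_inv_into_f inv_into_into)
  have U_eq': "U (\<Psi> S) = U' S" if "S \<in> Ob'" for S
    using U_eq[of "\<Psi> S"] \<Psi>[OF that] by simp
  have Hom_eq': "Hom (\<Psi> S) (\<Psi> T) = Hom' S T" if "S \<in> Ob'" "T \<in> Ob'" for S T
    using Hom_eq[of "\<Psi> S" "\<Psi> T"] \<Psi> that by simp
  have A: "small_category (concrete_category Ob U Hom)"
    by (rule small_category_concrete[OF Hom_ext Hom_id Hom_comp])
  have B: "small_category (concrete_category Ob' U' Hom')"
  proof (rule small_category_concrete)
    fix S T assume "S \<in> Ob'" "T \<in> Ob'"
    then show "Hom' S T \<subseteq> U' S \<rightarrow>\<^sub>E U' T"
      using Hom_ext[of "\<Psi> S" "\<Psi> T"] by (simp add: \<Psi> U_eq' Hom_eq')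
  next
    fix S assume "S \<in> Ob'"
    then show "(\<lambda>x\<in>U' S. x) \<in> Hom' S S"
      using Hom_id[of "\<Psi> S"] by (simp add: \<Psi> U_eq' Hom_eq')
  next
    fix S T V f g
    assume "S \<in> Ob'" "T \<in> Ob'" "V \<in> Ob'" "f \<in> Hom' S T" "g \<in> Hom' T V"
    then show "compose (U' S) g f \<in> Hom' S V"
      using Hom_comp[of "\<Psi> S" "\<Psi> T" "\<Psi> V" f g] by (simp add: \<Psi> U_eq' Hom_eq')
  qed
  let ?F = "\<lambda>(S, f, T). (\<Phi> S, f, \<Phi> T)" and ?G = "\<lambda>(S, f, T). (\<Psi> S, f, \<Psi> T)"
  have F: "is_functor (concrete_category Ob U Hom) (concrete_category Ob' U' Hom') ?F"
    unfolding is_functor_def concrete_category_def Let_def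
    by (auto simp: \<Phi> U_eq Hom_eq split: if_splits)
  have G: "is_functor (concrete_category Ob' U' Hom') (concrete_category Ob U Hom) ?G"
    unfolding is_functor_def concrete_category_def Let_def
    by (auto simp: \<Psi> U_eq' Hom_eq' split: if_splits)
  have GF: "\<forall>x\<in>arrows (concrete_category Ob U Hom). ?G (?F x) = x"
    and FG: "\<forall>y\<in>arrows (concrete_category Ob' U' Hom'). ?F (?G y) = y"
    unfolding concrete_category_def Let_def by (auto simp: \<Phi> \<Psi>)
  show ?thesis
    unfolding category_isomorphism_def using A B F G GF FG by blast
qed

section \<open>Ehresmann semigroups and their natural order\<close>

definition projections :: "'a biunary_semigroup \<Rightarrow> 'a set" where
  "projections S = dm S ` elems S"

context ehresmann_semigroup
begin

lemma closed [simp]: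
  "s \<in> elems S \<Longrightarrow> t \<in> elems S \<Longrightarrow> s \<cdot> t \<in> elems S"
  "s \<in> elems S \<Longrightarrow> \<D> s \<in> elems S"
  "s \<in> elems S \<Longrightarrow> \<R> s \<in> elems S"
  using mul_closed D_closed R_closed by (auto simp: PiE_iff)

lemma D_idem: "s \<in> elems S \<Longrightarrow> \<D> (\<D> s) = \<D> s"
  by (metis D_R R_D closed(2))

lemma projections_iff: "e \<in> projections S \<longleftrightarrow> e \<in> elems S \<and> \<D> e = e"
  unfolding projections_def by (auto simp: D_idem image_iff) (metis)

lemma projection:
  assumes "e \<in> projections S"
  shows "e \<in> elems S" "\<D> e = e" "\<R> e = e" "e \<cdot> e = e"
  using assms R_D[of e] D_mul[of e] by (auto simp: projections_iff)

lemma projections_closed [simp]: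
  "s \<in> elems S \<Longrightarrow> \<D> s \<in> projections S"
  "s \<in> elems S \<Longrightarrow> \<R> s \<in> projections S"
  "e \<in> projections S \<Longrightarrow> f \<in> projections S \<Longrightarrow> e \<cdot> f \<in> projections S"
  using D_idem D_R D_D_mul_D[of e f] by (auto simp: projections_iff)

lemma projections_commute:
  "e \<in> projections S \<Longrightarrow> f \<in> projections S \<Longrightarrow> e \<cdot> f = f \<cdot> e"
  using D_mul_D_commute[of e f] by (auto simp: projections_iff)

lemma D_projection_mul:
  "e \<in> projections S \<Longrightarrow> s \<in> elems S \<Longrightarrow> \<D> (e \<cdot> s) = e \<cdot> \<D> s"
  using D_of_mul[of e s] D_D_mul_D[of e s] by (auto simp: projections_iff)

lemma R_mul_projection:
  "f \<in> projections S \<Longrightarrow> s \<in> elems S \<Longrightarrow> \<R> (s \<cdot> f) = \<R> s \<cdot> f"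
  using R_of_mul[of s f] projection(3)[of "\<R> s \<cdot> f"] by (simp add: projection)

lemma D_mul_absorb: "s \<in> elems S \<Longrightarrow> t \<in> elems S \<Longrightarrow> \<D> s \<cdot> \<D> (s \<cdot> t) = \<D> (s \<cdot> t)"
  using D_projection_mul[of "\<D> s" "s \<cdot> t"] by (simp add: mul_assoc[symmetric] D_mul)

lemma R_mul_absorb: "s \<in> elems S \<Longrightarrow> t \<in> elems S \<Longrightarrow> \<R> (s \<cdot> t) \<cdot> \<R> t = \<R> (s \<cdot> t)"
  using R_mul_projection[of "\<R> t" "s \<cdot> t"] by (simp add: mul_assoc mul_R)

text \<open>The middle factor of the relational composite is eliminated: it has to be
  \<open>t \<cdot> \<R> s\<close>. In this form order-theoretic questions become equations, and it is visible
  that below \<open>t\<close> an element is determined by its two projections.\<close>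

lemma le_e_iff:
  "(s, t) \<in> le_e S \<longleftrightarrow> s \<in> elems S \<and> t \<in> elems S \<and> s = \<D> s \<cdot> (t \<cdot> \<R> s)"
proof
  assume "(s, t) \<in> le_e S"
  then obtain u where el: "s \<in> elems S" "t \<in> elems S" "u \<in> elems S"
    and su: "s = \<D> s \<cdot> u" and ut: "u = t \<cdot> \<R> u"
    unfolding le_e_def le_l_def le_r_def by auto
  have "\<R> s \<cdot> \<R> u = \<R> s" using R_mul_absorb[of "\<D> s" u] el su by simp
  then have Ru: "\<R> u \<cdot> \<R> s = \<R> s" using projections_commute[of "\<R> s" "\<R> u"] el by simp
  have "s = (\<D> s \<cdot> (t \<cdot> \<R> u)) \<cdot> \<R> s" using su ut mul_R el by metis
  also have "\<dots> = \<D> s \<cdot> (t \<cdot> (\<R> u \<cdot> \<R> s))" using el by (simp add: mul_assoc)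
  finally show "s \<in> elems S \<and> t \<in> elems S \<and> s = \<D> s \<cdot> (t \<cdot> \<R> s)" using el Ru by simp
next
  assume *: "s \<in> elems S \<and> t \<in> elems S \<and> s = \<D> s \<cdot> (t \<cdot> \<R> s)"
  have "\<R> s \<cdot> \<R> (t \<cdot> \<R> s) = \<R> s"
    using R_mul_absorb[of "\<D> s" "t \<cdot> \<R> s"] * by simp
  moreover have "\<R> (t \<cdot> \<R> s) = \<R> t \<cdot> \<R> s"
    using R_mul_projection * by simp
  ultimately have "\<R> (t \<cdot> \<R> s) = \<R> s"
    using projections_commute[of "\<R> t" "\<R> s"] projection(4)[of "\<R> s"] * mul_assoc[of "\<R> t" "\<R> s" "\<R> s"]
      projections_commute[of "\<R> s" "\<R> t \<cdot> \<R> s"]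
    by (metis closed(3) projections_closed(2,3))
  then have "(s, t \<cdot> \<R> s) \<in> le_l S" "(t \<cdot> \<R> s, t) \<in> le_r S"
    using * unfolding le_l_def le_r_def by auto
  then show "(s, t) \<in> le_e S" unfolding le_e_def by blast
qed

text \<open>Arbitrary projections may stand on either side of \<open>t\<close>: they lie above \<open>\<D> s\<close> and \<open>\<R> s\<close>, so they
  are absorbed when these are multiplied to \<open>s = e \<cdot> (t \<cdot> f)\<close>.\<close>

lemma le_eI:
  assumes t: "t \<in> elems S" and e: "e \<in> projections S" and f: "f \<in> projections S"
  shows "(e \<cdot> (t \<cdot> f), t) \<in> le_e S"
proof -
  define s where "s = e \<cdot> (t \<cdot> f)"
  note [simp] = projection(1)[OF e] projection(1)[OF f] t
  have s [simp]: "s \<in> elems S" by (simp add: s_def)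
  have "e \<cdot> \<D> s = \<D> s" using D_mul_absorb[of e "t \<cdot> f"] projection(2)[OF e] by (simp add: s_def)
  then have De: "\<D> s \<cdot> e = \<D> s" using projections_commute[OF e, of "\<D> s"] by simp
  have "\<R> s \<cdot> f = \<R> s"
    using R_mul_absorb[of "e \<cdot> t" f] projection(3)[OF f] by (simp add: s_def mul_assoc)
  then have Rf: "f \<cdot> \<R> s = \<R> s" using projections_commute[OF f, of "\<R> s"] by simp
  have "s = \<D> s \<cdot> (s \<cdot> \<R> s)" by (simp add: D_mul mul_R)
  also have "\<dots> = (\<D> s \<cdot> e) \<cdot> (t \<cdot> (f \<cdot> \<R> s))" by (subst (2) s_def) (simp add: mul_assoc)
  finally show ?thesis using De Rf le_e_iff[of s t] by (simp add: s_def[symmetric])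
qed

lemma le_e_projection_mul:
  "t \<in> elems S \<Longrightarrow> e \<in> projections S \<Longrightarrow> (e \<cdot> t, t) \<in> le_e S"
  using le_eI[of t e "\<R> t"] by (simp add: mul_R)

lemma le_e_mul_projection:
  "t \<in> elems S \<Longrightarrow> f \<in> projections S \<Longrightarrow> (t \<cdot> f, t) \<in> le_e S"
  using le_eI[of t "\<D> t" f] by (simp add: D_mul mul_assoc[symmetric] projection(1))

lemma le_e_DR:
  assumes "(s, t) \<in> le_e S"
  shows "\<D> s \<cdot> \<D> t = \<D> s" "\<R> s \<cdot> \<R> t = \<R> s"
proof -
  have el [simp]: "s \<in> elems S" "t \<in> elems S" and s: "s = \<D> s \<cdot> (t \<cdot> \<R> s)"
    using assms by (auto simp: le_e_iff)
  have "\<D> s = \<D> s \<cdot> \<D> (t \<cdot> \<R> s)"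
    using D_projection_mul[of "\<D> s" "t \<cdot> \<R> s"] s by simp
  moreover have "\<D> (t \<cdot> \<R> s) \<cdot> \<D> t = \<D> (t \<cdot> \<R> s)"
    using D_mul_absorb[of t "\<R> s"] projections_commute[of "\<D> t" "\<D> (t \<cdot> \<R> s)"] by simp
  ultimately show "\<D> s \<cdot> \<D> t = \<D> s"
    by (metis closed el(1,2) mul_assoc)
  have "\<R> s = \<R> (\<D> s \<cdot> t) \<cdot> \<R> s"
    using R_mul_projection[of "\<R> s" "\<D> s \<cdot> t"] s by (simp add: mul_assoc)
  moreover have "\<R> (\<D> s \<cdot> t) \<cdot> \<R> t = \<R> (\<D> s \<cdot> t)"
    using R_mul_absorb[of "\<D> s" t] by simp
  ultimately show "\<R> s \<cdot> \<R> t = \<R> s"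
    by (metis closed el(1,2) mul_assoc projections_closed(2) projections_commute)
qed

lemma le_e_projections_iff:
  assumes "e \<in> projections S" "f \<in> projections S"
  shows "(e, f) \<in> le_e S \<longleftrightarrow> e \<cdot> f = e"
proof -
  have "e \<cdot> (f \<cdot> e) = e \<cdot> f"
    using assms projections_commute[of f e] projection(4)[of e] mul_assoc[of e e f]
    by (simp add: projection(1))
  then show ?thesis using assms by (auto simp: le_e_iff projection)
qed

lemma partial_order_le_e: "partial_order_on (elems S) (le_e S)"
proof -
  have "le_e S \<subseteq> elems S \<times> elems S" by (auto simp: le_e_iff)
  moreover have "refl_on (elems S) (le_e S)"
    by (auto simp: refl_on_def le_e_iff D_mul mul_R)
  moreover have "trans (le_e S)"
  proof (rule transI)
    fix s t u assume st: "(s, t) \<in> le_e S" and tu: "(t, u) \<in> le_e S"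
    then have [simp]: "s \<in> elems S" "t \<in> elems S" "u \<in> elems S" by (auto simp: le_e_iff)
    have "s = \<D> s \<cdot> (t \<cdot> \<R> s)" "t = \<D> t \<cdot> (u \<cdot> \<R> t)"
      using st tu le_e_iff by blast+
    then have "s = \<D> s \<cdot> ((\<D> t \<cdot> (u \<cdot> \<R> t)) \<cdot> \<R> s)" by metis
    then have "s = (\<D> s \<cdot> \<D> t) \<cdot> (u \<cdot> (\<R> t \<cdot> \<R> s))" by (simp add: mul_assoc)
    then show "(s, u) \<in> le_e S"
      using le_eI[of u "\<D> s \<cdot> \<D> t" "\<R> t \<cdot> \<R> s"] by simp
  qed
  moreover have "antisym (le_e S)"
  proof (rule antisymI)
    fix s t assume st: "(s, t) \<in> le_e S" and ts: "(t, s) \<in> le_e S"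
    then have [simp]: "s \<in> elems S" "t \<in> elems S" by (auto simp: le_e_iff)
    have "\<D> s = \<D> t" "\<R> s = \<R> t"
      using le_e_DR[OF st] le_e_DR[OF ts] projections_commute[of "\<D> s" "\<D> t"]
        projections_commute[of "\<R> s" "\<R> t"] by simp_all
    moreover have "s = \<D> s \<cdot> (t \<cdot> \<R> s)" using st le_e_iff by blast
    ultimately show "s = t" by (simp add: D_mul mul_R)
  qed
  ultimately show ?thesis by (simp add: partial_order_on_def preorder_on_def)
qed

end

section \<open>The ordered category of a de Barros semigroup\<close>

definition category_of_semigroup :: "'a biunary_semigroup \<Rightarrow> 'a ordered_category_struct" where
  "category_of_semigroup S =
     \<lparr> arrows = elems S,
       cmp = (\<lambda>x y. if x \<in> elems S \<and> y \<in> elems S \<and> rg S x = dm S y then Some (mul S x y) else None),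
       src = dm S, trg = rg S, ord = le_e S \<rparr>"

lemma category_of_semigroup_sel [simp]:
  "arrows (category_of_semigroup S) = elems S"
  "src (category_of_semigroup S) = dm S"
  "trg (category_of_semigroup S) = rg S"
  "ord (category_of_semigroup S) = le_e S"
  "identities (category_of_semigroup S) = projections S"
  by (simp_all add: category_of_semigroup_def identities_def projections_def)

lemma cmp_category_of_semigroup:
  "cmp (category_of_semigroup S) x y = Some z \<longleftrightarrow>
     x \<in> elems S \<and> y \<in> elems S \<and> rg S x = dm S y \<and> z = mul S x y"
  by (auto simp: category_of_semigroup_def)

lemma greatest_unique:
  assumes "antisym r" "is_greatest r A m" "is_greatest r A m'"
  shows "m = m'"
  using assms unfolding is_greatest_def antisym_def by blast

context ehresmann_semigroup
begin

text \<open>If \<open>\<R> x = \<D> y\<close>, then \<open>\<D> (x \<cdot> y) = \<D> (x \<cdot> \<D> y) = \<D> (x \<cdot> \<R> x) = \<D> x\<close>, and dually for \<open>\<R>\<close>.\<close>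

lemma small_category_of_semigroup: "small_category (category_of_semigroup S)"
proof (unfold_locales, goal_cases)
  \<comment> \<open>source and target of a composite, and the domain of composition\<close>
  case (9 x y z)
  then show ?case
    using D_of_mul[of x y] by (auto simp: cmp_category_of_semigroup mul_R) (metis mul_R)
next
  case (10 x y z)
  then show ?case
    using R_of_mul[of x y] by (auto simp: cmp_category_of_semigroup) (metis D_mul)
next
  case (8 x y)
  then show ?case by (simp add: category_of_semigroup_def)
qed (auto simp: D_closed R_closed cmp_category_of_semigroup D_mul mul_R D_R R_D mul_assoc)

lemma is_left_restriction_mul:
  assumes x: "x \<in> elems S" and e: "e \<in> projections S"
  shows "is_left_restriction (category_of_semigroup S) e x (e \<cdot> x)"
proof -
  note el [simp] = x projection(1)[OF e]
  have "\<D> (e \<cdot> x) \<cdot> e = \<D> (e \<cdot> x)"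
    using D_mul_absorb[of e x] projections_commute[OF e, of "\<D> (e \<cdot> x)"] projection(2)[OF e]
    by simp
  then have "(\<D> (e \<cdot> x), e) \<in> le_e S"
    by (simp add: le_e_projections_iff e)
  moreover have "(y, e \<cdot> x) \<in> le_e S" if yx: "(y, x) \<in> le_e S" and ye: "(\<D> y, e) \<in> le_e S" for y
  proof -
    have y: "y \<in> elems S" "y = \<D> y \<cdot> (x \<cdot> \<R> y)" using yx le_e_iff by blast+
    have "\<D> y \<cdot> e = \<D> y" using ye y e by (simp add: le_e_projections_iff)
    then have "y = \<D> y \<cdot> ((e \<cdot> x) \<cdot> \<R> y)"
      using y mul_assoc[of "\<D> y" e "x \<cdot> \<R> y"] by (simp add: mul_assoc)
    then show ?thesis using y(1) by (simp add: le_e_iff)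
  qed
  ultimately show ?thesis
    by (simp add: is_left_restriction_def is_greatest_def le_e_projection_mul e)
qed

lemma is_right_restriction_mul:
  assumes x: "x \<in> elems S" and e: "e \<in> projections S"
  shows "is_right_restriction (category_of_semigroup S) x e (x \<cdot> e)"
proof -
  note el [simp] = x projection(1)[OF e]
  have "\<R> (x \<cdot> e) \<cdot> e = \<R> (x \<cdot> e)"
    using R_mul_absorb[of x e] projection(3)[OF e] by simp
  then have "(\<R> (x \<cdot> e), e) \<in> le_e S"
    by (simp add: le_e_projections_iff e)
  moreover have "(y, x \<cdot> e) \<in> le_e S" if yx: "(y, x) \<in> le_e S" and ye: "(\<R> y, e) \<in> le_e S" for y
  proof -
    have y: "y \<in> elems S" "y = \<D> y \<cdot> (x \<cdot> \<R> y)" using yx le_e_iff by blast+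
    have "e \<cdot> \<R> y = \<R> y"
      using ye y e projections_commute[OF e, of "\<R> y"] by (simp add: le_e_projections_iff)
    then have "y = \<D> y \<cdot> ((x \<cdot> e) \<cdot> \<R> y)"
      using y by (simp add: mul_assoc)
    then show ?thesis using y(1) by (simp add: le_e_iff)
  qed
  ultimately show ?thesis
    by (simp add: is_right_restriction_def is_greatest_def le_e_mul_projection e)
qed

lemma is_meet_mul:
  assumes e: "e \<in> projections S" and f: "f \<in> projections S"
  shows "is_meet (category_of_semigroup S) e f (e \<cdot> f)"
proof -
  note el = projection(1)[OF e] projection(1)[OF f]
  have "(e \<cdot> f, e) \<in> le_e S" "(e \<cdot> f, f) \<in> le_e S"
    using le_e_mul_projection le_e_projection_mul e f el by blast+
  moreover have "(g, e \<cdot> f) \<in> le_e S"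
    if "g \<in> projections S" "(g, e) \<in> le_e S" "(g, f) \<in> le_e S" for g
    using that e f el mul_assoc[of g e f] by (simp add: le_e_projections_iff projection(1))
  ultimately show ?thesis by (simp add: is_meet_def is_greatest_def e f)
qed

lemma antisym_le_e: "antisym (le_e S)"
  using partial_order_le_e by (simp add: partial_order_on_def)

lemma left_restriction_eq_mul:
  "x \<in> elems S \<Longrightarrow> e \<in> projections S \<Longrightarrow> left_restriction (category_of_semigroup S) e x = e \<cdot> x"
  unfolding left_restriction_def
  by (rule the_equality, erule (1) is_left_restriction_mul, drule (1) is_left_restriction_mul)
    (auto simp: is_left_restriction_def intro: greatest_unique[OF antisym_le_e])

lemma right_restriction_eq_mul:
  "x \<in> elems S \<Longrightarrow> e \<in> projections S \<Longrightarrow> right_restriction (category_of_semigroup S) x e = x \<cdot> e"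
  unfolding right_restriction_def
  by (rule the_equality, erule (1) is_right_restriction_mul, drule (1) is_right_restriction_mul)
    (auto simp: is_right_restriction_def intro: greatest_unique[OF antisym_le_e])

lemma meet_eq_mul:
  "e \<in> projections S \<Longrightarrow> f \<in> projections S \<Longrightarrow> meet (category_of_semigroup S) e f = e \<cdot> f"
  unfolding meet_def
  by (rule the_equality, erule (1) is_meet_mul, drule (1) is_meet_mul)
    (auto simp: is_meet_def intro: greatest_unique[OF antisym_le_e])

lemma OC4_category_of_semigroup: "OC4 (category_of_semigroup S)"
  unfolding OC4_def
proof (intro ballI impI)
  fix a b
  assume "a \<in> arrows (category_of_semigroup S)" "b \<in> arrows (category_of_semigroup S)"
    and "(a, b) \<in> ord (category_of_semigroup S) \<and>
      src (category_of_semigroup S) a = src (category_of_semigroup S) b \<and>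
      trg (category_of_semigroup S) a = trg (category_of_semigroup S) b"
  then have "a = \<D> b \<cdot> (b \<cdot> \<R> b)" "b \<in> elems S" using le_e_iff[of a b] by auto
  then show "a = b" by (simp add: D_mul mul_R)
qed

text \<open>Condition (OC7') holds with equality. From \<open>a = (\<D> a \<cdot> b) \<cdot> (c \<cdot> \<R> a)\<close> one obtains composable factors
  by multiplying each of the two by the projection of the other at the middle; these
  projections are absorbed in the product because each is already present in its own factor.\<close>

lemma le_e_mul_splits:
  assumes b: "b \<in> elems S" and c: "c \<in> elems S" and RD: "\<R> b = \<D> c"
    and a: "(a, b \<cdot> c) \<in> le_e S"
  obtains b' c' where "(b', b) \<in> le_e S" "(c', c) \<in> le_e S" "\<D> b' = \<D> a" "\<R> c' = \<R> a"
    "\<R> b' = \<D> c'" "a = b' \<cdot> c'"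
proof -
  note [simp] = b c
  have a_el [simp]: "a \<in> elems S" and a_eq: "a = \<D> a \<cdot> ((b \<cdot> c) \<cdot> \<R> a)"
    using a le_e_iff by blast+
  define f where "f = \<R> (\<D> a \<cdot> b)"
  define g where "g = \<D> (c \<cdot> \<R> a)"
  have fg [simp]: "f \<in> projections S" "g \<in> projections S" "f \<in> elems S" "g \<in> elems S"
    by (simp_all add: f_def g_def)
  define b' where "b' = \<D> a \<cdot> (b \<cdot> g)"
  define c' where "c' = (f \<cdot> c) \<cdot> \<R> a"
  have "\<D> b' = \<D> ((\<D> a \<cdot> b) \<cdot> g)" by (simp add: b'_def mul_assoc)
  also have "\<dots> = \<D> ((\<D> a \<cdot> b) \<cdot> (c \<cdot> \<R> a))"
    using D_of_mul[of "\<D> a \<cdot> b" "c \<cdot> \<R> a"] by (simp add: g_def)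
  also have "(\<D> a \<cdot> b) \<cdot> (c \<cdot> \<R> a) = a" using a_eq by (simp add: mul_assoc)
  finally have 1: "\<D> b' = \<D> a" .
  have "\<R> c' = \<R> (f \<cdot> (c \<cdot> \<R> a))" by (simp add: c'_def mul_assoc)
  also have "\<dots> = \<R> ((\<D> a \<cdot> b) \<cdot> (c \<cdot> \<R> a))"
    using R_of_mul[of "\<D> a \<cdot> b" "c \<cdot> \<R> a"] by (simp add: f_def)
  also have "(\<D> a \<cdot> b) \<cdot> (c \<cdot> \<R> a) = a" using a_eq by (simp add: mul_assoc)
  finally have 2: "\<R> c' = \<R> a" .
  have "\<R> b' = f \<cdot> g"
    using R_mul_projection[of g "\<D> a \<cdot> b"] by (simp add: b'_def f_def mul_assoc)
  moreover have "\<D> c' = f \<cdot> g"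
    using D_projection_mul[of f "c \<cdot> \<R> a"] by (simp add: c'_def g_def mul_assoc)
  ultimately have 3: "\<R> b' = \<D> c'" by simp
  have "b' \<cdot> c' = (\<D> a \<cdot> b) \<cdot> ((g \<cdot> f) \<cdot> (c \<cdot> \<R> a))"
    by (simp add: b'_def c'_def mul_assoc)
  also have "\<dots> = ((\<D> a \<cdot> b) \<cdot> f) \<cdot> (g \<cdot> (c \<cdot> \<R> a))"
    by (simp add: projections_commute[of g f] mul_assoc)
  also have "\<dots> = (\<D> a \<cdot> b) \<cdot> (c \<cdot> \<R> a)"
    using mul_R[of "\<D> a \<cdot> b"] D_mul[of "c \<cdot> \<R> a"] by (simp add: f_def g_def)
  also have "\<dots> = a" using a_eq by (simp add: mul_assoc)
  finally have 4: "a = b' \<cdot> c'" by simp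
  have "(b', b) \<in> le_e S" "(c', c) \<in> le_e S"
    using le_eI[of b "\<D> a" g] le_eI[of c f "\<R> a"] by (simp_all add: b'_def c'_def mul_assoc)
  with 1 2 3 4 show ?thesis using that by blast
qed

end

text \<open>The compatibility of \<open>\<le>\<^sub>e\<close> with multiplication is what makes composition monotone.\<close>

lemma (in de_Barros_semigroup) ehresmann_ordered_category_of_semigroup:
  "ehresmann_ordered_category (category_of_semigroup S)"
proof -
  interpret small_category "category_of_semigroup S" by (rule small_category_of_semigroup)
  show ?thesis
  proof (unfold_locales, goal_cases)
    case 1
    then show ?case by (simp add: partial_order_le_e)
  next
    case (2 a b)
    then have "a \<in> elems S" "b \<in> elems S" by (auto simp: le_e_iff)
    with 2 show ?case by (simp add: le_e_projections_iff le_e_DR)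
  next
    case (3 a b)
    then have "a \<in> elems S" "b \<in> elems S" by (auto simp: le_e_iff)
    with 3 show ?case by (simp add: le_e_projections_iff le_e_DR)
  next
    case (4 a b c d ac bd)
    then show ?case using le_e_mul by (simp add: cmp_category_of_semigroup)
  next
    case (5 x e)
    then have "\<D> (e \<cdot> x) = e" by (simp add: D_projection_mul le_e_projections_iff)
    with 5 show ?case using is_left_restriction_mul by auto
  next
    case (6 x e)
    then have "\<R> (x \<cdot> e) = e"
      using projections_commute[of e "\<R> x"] by (simp add: R_mul_projection le_e_projections_iff)
    with 6 show ?case using is_right_restriction_mul by auto
  next
    case (7 b c bc a)
    then obtain b' c' where "(b', b) \<in> le_e S" "(c', c) \<in> le_e S" "\<D> b' = \<D> a" "\<R> c' = \<R> a"
      "\<R> b' = \<D> c'" "a = b' \<cdot> c'"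
      using le_e_mul_splits[of b c a] by (auto simp: cmp_category_of_semigroup)
    moreover have "(a, a) \<in> le_e S"
      using 7 partial_order_le_e by (auto simp: partial_order_on_def preorder_on_def refl_on_def)
    moreover have "b' \<in> elems S" "c' \<in> elems S"
      using \<open>(b', b) \<in> le_e S\<close> \<open>(c', c) \<in> le_e S\<close> by (simp_all add: le_e_iff)
    ultimately have "(b', b) \<in> le_e S \<and> (c', c) \<in> le_e S \<and> \<D> a = \<D> b' \<and> \<R> a = \<R> c' \<and>
      cmp (category_of_semigroup S) b' c' = Some a \<and> (a, a) \<in> le_e S"
      by (simp add: cmp_category_of_semigroup)
    then show ?case unfolding category_of_semigroup_sel by blast
  next
    case (8 a e)
    then have "a = \<D> a \<cdot> (e \<cdot> \<R> a)" "a \<in> elems S" "e \<in> projections S" using le_e_iff by auto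
    then have "a \<in> projections S" by (metis projections_closed)
    then show ?case by simp
  next
    case (9 e f)
    then show ?case using is_meet_mul by auto
  qed
qed

section \<open>The pseudoproduct of an Ehresmann-ordered category\<close>

definition pseudoproduct :: "'a ordered_category_struct \<Rightarrow> 'a \<Rightarrow> 'a \<Rightarrow> 'a" where
  "pseudoproduct C a b =
    (let e = meet C (trg C a) (src C b)
     in the (cmp C (right_restriction C a e) (left_restriction C e b)))"

text \<open>The restricted abstractions make the multiplication extensional in both
  arguments, so that the passage from semigroups to categories and back is the identity also off the
  carrier.\<close>

definition semigroup_of_category :: "'a ordered_category_struct \<Rightarrow> 'a biunary_semigroup" where
  "semigroup_of_category C =
     \<lparr> elems = arrows C,
       mul = (\<lambda>x\<in>arrows C. \<lambda>y\<in>arrows C. pseudoproduct C x y),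
       dm = src C, rg = trg C \<rparr>"

lemma semigroup_of_category_sel [simp]:
  "elems (semigroup_of_category C) = arrows C"
  "dm (semigroup_of_category C) = src C"
  "rg (semigroup_of_category C) = trg C"
  "projections (semigroup_of_category C) = identities C"
  by (simp_all add: semigroup_of_category_def identities_def projections_def)

lemma mul_semigroup_of_category [simp]:
  "x \<in> arrows C \<Longrightarrow> y \<in> arrows C \<Longrightarrow> mul (semigroup_of_category C) x y = pseudoproduct C x y"
  by (simp add: semigroup_of_category_def)

context ehresmann_ordered_category
begin

abbreviation pprod (infixl "\<otimes>" 70) where "a \<otimes> b \<equiv> pseudoproduct C a b"

lemma
  shows ord_refl: "x \<in> arrows C \<Longrightarrow> x \<sqsubseteq> x"
    and ord_trans: "x \<sqsubseteq> y \<Longrightarrow> y \<sqsubseteq> z \<Longrightarrow> x \<sqsubseteq> z"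
    and antisym_ord: "antisym (ord C)"
    and ord_antisym: "x \<sqsubseteq> y \<Longrightarrow> y \<sqsubseteq> x \<Longrightarrow> x = y"
    and ord_arrows: "x \<sqsubseteq> y \<Longrightarrow> x \<in> arrows C \<and> y \<in> arrows C"
proof -
  note po = partial_order_onD[OF partial_order]
  show "x \<in> arrows C \<Longrightarrow> x \<sqsubseteq> x" using po(1) by (rule refl_onD)
  show "x \<sqsubseteq> y \<Longrightarrow> y \<sqsubseteq> z \<Longrightarrow> x \<sqsubseteq> z" using po(2) by (rule transD)
  show "antisym (ord C)" by (rule po(3))
  then show "x \<sqsubseteq> y \<Longrightarrow> y \<sqsubseteq> x \<Longrightarrow> x = y" by (rule antisymD)
  show "x \<sqsubseteq> y \<Longrightarrow> x \<in> arrows C \<and> y \<in> arrows C" using po(4) by auto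
qed

lemma src_trg_arrows [simp]:
  "x \<in> arrows C \<Longrightarrow> \<^bold>D x \<in> arrows C" "x \<in> arrows C \<Longrightarrow> \<^bold>R x \<in> arrows C"
  using src_closed trg_closed by auto

lemma src_src: "x \<in> arrows C \<Longrightarrow> \<^bold>D (\<^bold>D x) = \<^bold>D x"
  by (metis src_trg trg_src src_trg_arrows(1))

lemma src_trg_identities [simp]:
  "x \<in> arrows C \<Longrightarrow> \<^bold>D x \<in> identities C" "x \<in> arrows C \<Longrightarrow> \<^bold>R x \<in> identities C"
proof -
  show "x \<in> arrows C \<Longrightarrow> \<^bold>D x \<in> identities C" by (simp add: identities_def)
  show "x \<in> arrows C \<Longrightarrow> \<^bold>R x \<in> identities C"
    unfolding identities_def by (rule image_eqI[of _ _ "\<^bold>R x"]) (simp_all add: src_trg)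
qed

lemma identityD:
  assumes "e \<in> identities C"
  shows "e \<in> arrows C" "\<^bold>D e = e" "\<^bold>R e = e" "cmp C e e = Some e"
  using assms src_cmp[of e] unfolding identities_def by (auto simp: src_src trg_src)

lemma cmp_exists:
  assumes "x \<in> arrows C" "y \<in> arrows C" "\<^bold>R x = \<^bold>D y"
  shows "\<exists>z. cmp C x y = Some z \<and> z \<in> arrows C"
  using assms cmp_defined_iff[of x y] cmp_closed[of x y] by blast

lemma cmp_src_trg: "cmp C x y = Some z \<Longrightarrow> \<^bold>R x = \<^bold>D y"
  using cmp_closed[of x y z] cmp_defined_iff[of x y] by auto

lemma cmp_assoc_iff:
  "(\<exists>u. cmp C x y = Some u \<and> cmp C u z = Some w) \<longleftrightarrow>
   (\<exists>v. cmp C y z = Some v \<and> cmp C x v = Some w)"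
proof
  assume "\<exists>u. cmp C x y = Some u \<and> cmp C u z = Some w"
  then obtain u where u: "cmp C x y = Some u" "cmp C u z = Some w" by blast
  then have el: "x \<in> arrows C" "y \<in> arrows C" "z \<in> arrows C"
    using cmp_closed[OF u(1)] cmp_closed[OF u(2)] by simp_all
  obtain v where v: "cmp C y z = Some v" "v \<in> arrows C"
    using cmp_exists[of y z] el cmp_src_trg[OF u(2)] trg_of_cmp[OF u(1)] by auto
  obtain w' where "cmp C x v = Some w'"
    using cmp_exists[of x v] el v cmp_src_trg[OF u(1)] src_of_cmp[OF v(1)] by auto
  then show "\<exists>v. cmp C y z = Some v \<and> cmp C x v = Some w"
    using cmp_assoc[OF u v(1)] v by auto
next
  assume "\<exists>v. cmp C y z = Some v \<and> cmp C x v = Some w"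
  then obtain v where v: "cmp C y z = Some v" "cmp C x v = Some w" by blast
  then have el: "x \<in> arrows C" "y \<in> arrows C" "z \<in> arrows C"
    using cmp_closed[OF v(1)] cmp_closed[OF v(2)] by simp_all
  obtain u where u: "cmp C x y = Some u" "u \<in> arrows C"
    using cmp_exists[of x y] el cmp_src_trg[OF v(2)] src_of_cmp[OF v(1)] by auto
  obtain w' where "cmp C u z = Some w'"
    using cmp_exists[of u z] el u cmp_src_trg[OF v(1)] trg_of_cmp[OF u(1)] by auto
  then show "\<exists>u. cmp C x y = Some u \<and> cmp C u z = Some w"
    using cmp_assoc[OF u(1) _ v] u by auto
qed

lemma meet:
  assumes "e \<in> identities C" "f \<in> identities C"
  shows "meet C e f \<in> identities C" "meet C e f \<sqsubseteq> e" "meet C e f \<sqsubseteq> f"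
    and "g \<in> identities C \<Longrightarrow> g \<sqsubseteq> e \<Longrightarrow> g \<sqsubseteq> f \<Longrightarrow> g \<sqsubseteq> meet C e f"
proof -
  obtain m where m: "is_meet C e f m" using meet_exists[OF assms] by blast
  have "meet C e f = m" unfolding meet_def
  proof (rule the_equality[where P = "is_meet C e f", OF m])
    show "m' = m" if "is_meet C e f m'" for m'
      using that m unfolding is_meet_def by (rule greatest_unique[OF antisym_ord])
  qed
  then show "meet C e f \<in> identities C" "meet C e f \<sqsubseteq> e" "meet C e f \<sqsubseteq> f"
    "g \<in> identities C \<Longrightarrow> g \<sqsubseteq> e \<Longrightarrow> g \<sqsubseteq> f \<Longrightarrow> g \<sqsubseteq> meet C e f"
    using m unfolding is_meet_def is_greatest_def by simp_all
qed

lemma meet_eqI: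
  assumes "e \<in> identities C" "f \<in> identities C" "m \<in> identities C" "m \<sqsubseteq> e" "m \<sqsubseteq> f"
    and "\<And>g. g \<in> identities C \<Longrightarrow> g \<sqsubseteq> e \<Longrightarrow> g \<sqsubseteq> f \<Longrightarrow> g \<sqsubseteq> m"
  shows "meet C e f = m"
proof (rule ord_antisym)
  show "meet C e f \<sqsubseteq> m" by (rule assms(6)) (rule meet[OF assms(1,2)])+
  show "m \<sqsubseteq> meet C e f" by (rule meet(4)) (rule assms)+
qed

lemma meet_commute: "e \<in> identities C \<Longrightarrow> f \<in> identities C \<Longrightarrow> meet C e f = meet C f e"
  by (rule meet_eqI) (simp_all add: meet)

lemma meet_absorb: "e \<in> identities C \<Longrightarrow> f \<in> identities C \<Longrightarrow> e \<sqsubseteq> f \<Longrightarrow> meet C e f = e"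
  by (rule meet_eqI) (simp_all add: ord_refl identityD)

lemma left_restriction:
  assumes "x \<in> arrows C" "e \<in> identities C" "e \<sqsubseteq> \<^bold>D x"
  shows "left_restriction C e x \<sqsubseteq> x" "\<^bold>D (left_restriction C e x) = e"
    and "y \<sqsubseteq> x \<Longrightarrow> \<^bold>D y \<sqsubseteq> e \<Longrightarrow> y \<sqsubseteq> left_restriction C e x"
proof -
  obtain y where y: "is_left_restriction C e x y" "\<^bold>D y = e" using OC6_left[OF assms] by blast
  then have "left_restriction C e x = y"
    unfolding left_restriction_def
  proof (intro the_equality)
    show "y' = y" if "is_left_restriction C e x y'" for y'
      using that y(1) unfolding is_left_restriction_def by (rule greatest_unique[OF antisym_ord])
  qed
  with y show "left_restriction C e x \<sqsubseteq> x" "\<^bold>D (left_restriction C e x) = e"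
    "\<And>y. y \<sqsubseteq> x \<Longrightarrow> \<^bold>D y \<sqsubseteq> e \<Longrightarrow> y \<sqsubseteq> left_restriction C e x"
    unfolding is_left_restriction_def is_greatest_def by auto
qed

lemma right_restriction:
  assumes "x \<in> arrows C" "e \<in> identities C" "e \<sqsubseteq> \<^bold>R x"
  shows "right_restriction C x e \<sqsubseteq> x" "\<^bold>R (right_restriction C x e) = e"
    and "y \<sqsubseteq> x \<Longrightarrow> \<^bold>R y \<sqsubseteq> e \<Longrightarrow> y \<sqsubseteq> right_restriction C x e"
proof -
  obtain y where y: "is_right_restriction C x e y" "\<^bold>R y = e" using OC6_right[OF assms] by blast
  then have "right_restriction C x e = y"
    unfolding right_restriction_def
  proof (intro the_equality)
    show "y' = y" if "is_right_restriction C x e y'" for y'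
      using that y(1) unfolding is_right_restriction_def by (rule greatest_unique[OF antisym_ord])
  qed
  with y show "right_restriction C x e \<sqsubseteq> x" "\<^bold>R (right_restriction C x e) = e"
    "\<And>y. y \<sqsubseteq> x \<Longrightarrow> \<^bold>R y \<sqsubseteq> e \<Longrightarrow> y \<sqsubseteq> right_restriction C x e"
    unfolding is_right_restriction_def is_greatest_def by auto
qed

lemma left_restriction_src: "x \<in> arrows C \<Longrightarrow> left_restriction C (\<^bold>D x) x = x"
  by (rule ord_antisym) (simp_all add: left_restriction ord_refl)

lemma right_restriction_trg: "x \<in> arrows C \<Longrightarrow> right_restriction C x (\<^bold>R x) = x"
  by (rule ord_antisym) (simp_all add: right_restriction ord_refl)

lemma left_restriction_identity:
  assumes "e \<in> identities C" "f \<in> identities C" "e \<sqsubseteq> f"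
  shows "left_restriction C e f = e"
proof -
  have "left_restriction C e f \<sqsubseteq> f" "\<^bold>D (left_restriction C e f) = e"
    using left_restriction[of f e] assms by (simp_all add: identityD)
  moreover from this have "left_restriction C e f \<in> identities C"
    using OCI assms(2) ord_arrows by blast
  ultimately show ?thesis using identityD(2) by simp
qed

lemma right_restriction_identity:
  assumes "e \<in> identities C" "f \<in> identities C" "e \<sqsubseteq> f"
  shows "right_restriction C f e = e"
proof -
  have "right_restriction C f e \<sqsubseteq> f" "\<^bold>R (right_restriction C f e) = e"
    using right_restriction[of f e] assms by (simp_all add: identityD)
  moreover from this have "right_restriction C f e \<in> identities C"
    using OCI assms(2) ord_arrows by blast
  ultimately show ?thesis using identityD(3) by simp
qed

lemma pseudoproduct_cmp:
  assumes "a \<in> arrows C" "b \<in> arrows C"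
  defines "e \<equiv> meet C (\<^bold>R a) (\<^bold>D b)"
  shows "cmp C (right_restriction C a e) (left_restriction C e b) = Some (a \<otimes> b)"
proof -
  have e: "e \<in> identities C" "e \<sqsubseteq> \<^bold>R a" "e \<sqsubseteq> \<^bold>D b" using meet assms by simp_all
  obtain z where "cmp C (right_restriction C a e) (left_restriction C e b) = Some z"
    using cmp_exists[of "right_restriction C a e" "left_restriction C e b"]
      right_restriction[OF assms(1) e(1,2)] left_restriction[OF assms(2) e(1,3)] ord_arrows
    by metis
  then show ?thesis unfolding pseudoproduct_def e_def Let_def by simp
qed

lemma pseudoproduct_closed [simp]: "a \<in> arrows C \<Longrightarrow> b \<in> arrows C \<Longrightarrow> a \<otimes> b \<in> arrows C"
  using cmp_closed[OF pseudoproduct_cmp] by simp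

text \<open>If \<open>a' \<circ> b'\<close> is such a composite, then \<open>\<^bold>R a' = \<^bold>D b'\<close> is an identity below \<open>\<^bold>R a\<close> and \<open>\<^bold>D b\<close>, hence
  below their meet \<open>e\<close>; thus \<open>a' \<sqsubseteq> a|e\<close> and \<open>b' \<sqsubseteq> e|b\<close>, and composition is monotone.\<close>

lemma pseudoproduct_greatest:
  assumes "a \<in> arrows C" "b \<in> arrows C"
  shows "is_greatest (ord C) {x. \<exists>a' b'. a' \<sqsubseteq> a \<and> b' \<sqsubseteq> b \<and> cmp C a' b' = Some x} (a \<otimes> b)"
proof -
  define e where "e = meet C (\<^bold>R a) (\<^bold>D b)"
  have e: "e \<in> identities C" "e \<sqsubseteq> \<^bold>R a" "e \<sqsubseteq> \<^bold>D b" using meet assms by (simp_all add: e_def)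
  note ra = right_restriction[OF assms(1) e(1,2)]
  note lb = left_restriction[OF assms(2) e(1,3)]
  have c: "cmp C (right_restriction C a e) (left_restriction C e b) = Some (a \<otimes> b)"
    using pseudoproduct_cmp assms by (simp add: e_def)
  have "x \<sqsubseteq> a \<otimes> b" if "a' \<sqsubseteq> a" "b' \<sqsubseteq> b" "cmp C a' b' = Some x" for a' b' x
  proof -
    have eq: "\<^bold>R a' = \<^bold>D b'" using cmp_src_trg that by blast
    have "\<^bold>R a' \<sqsubseteq> e" unfolding e_def
    proof (rule meet(4))
      show "\<^bold>R a' \<sqsubseteq> \<^bold>R a" using trg_mono that by blast
      show "\<^bold>R a' \<sqsubseteq> \<^bold>D b" using src_mono[OF that(2)] eq by simp
    qed (use assms that ord_arrows in auto)
    then have "a' \<sqsubseteq> right_restriction C a e" "b' \<sqsubseteq> left_restriction C e b"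
      using ra(3) lb(3) that eq by auto
    then show ?thesis using cmp_mono that(3) c by blast
  qed
  then show ?thesis
    unfolding is_greatest_def using ra(1) lb(1) c by blast
qed

lemma cmp_le_pseudoproduct: "a' \<sqsubseteq> a \<Longrightarrow> b' \<sqsubseteq> b \<Longrightarrow> cmp C a' b' = Some x \<Longrightarrow> x \<sqsubseteq> a \<otimes> b"
  using pseudoproduct_greatest[of a b] ord_arrows unfolding is_greatest_def by blast

lemma pseudoproduct_splits:
  assumes "a \<in> arrows C" "b \<in> arrows C"
  shows "\<exists>a' b'. a' \<sqsubseteq> a \<and> b' \<sqsubseteq> b \<and> cmp C a' b' = Some (a \<otimes> b)"
  using pseudoproduct_greatest[OF assms] unfolding is_greatest_def by blast

lemma pseudoproduct_mono:
  assumes "a \<sqsubseteq> c" "b \<sqsubseteq> d"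
  shows "a \<otimes> b \<sqsubseteq> c \<otimes> d"
proof -
  obtain a' b' where "a' \<sqsubseteq> a" "b' \<sqsubseteq> b" "cmp C a' b' = Some (a \<otimes> b)"
    using pseudoproduct_splits[of a b] assms ord_arrows by blast
  then show ?thesis using cmp_le_pseudoproduct ord_trans assms by blast
qed

lemma pseudoproduct_eq_cmp:
  assumes "cmp C a b = Some c"
  shows "a \<otimes> b = c"
proof -
  have el: "a \<in> arrows C" "b \<in> arrows C" and eq: "\<^bold>R a = \<^bold>D b"
    using cmp_closed[OF assms] cmp_src_trg[OF assms] by simp_all
  then have "meet C (\<^bold>R a) (\<^bold>D b) = \<^bold>R a" by (simp add: meet_absorb ord_refl)
  then show ?thesis
    using pseudoproduct_cmp[OF el] assms eq el right_restriction_trg[OF el(1)]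
    by (simp add: left_restriction_src)
qed

lemma identity_pseudoproduct:
  assumes e: "e \<in> identities C" and x: "x \<in> arrows C"
  shows "e \<otimes> x = left_restriction C (meet C e (\<^bold>D x)) x"
proof -
  define g where "g = meet C e (\<^bold>D x)"
  have g: "g \<in> identities C" "g \<sqsubseteq> e" "g \<sqsubseteq> \<^bold>D x" using meet assms by (simp_all add: g_def)
  note l = left_restriction[OF x g(1,3)]
  have "cmp C g (left_restriction C g x) = Some (e \<otimes> x)"
    using pseudoproduct_cmp[of e x] e x g
    by (simp add: identityD right_restriction_identity flip: g_def)
  moreover have "cmp C g (left_restriction C g x) = Some (left_restriction C g x)"
    using src_cmp[of "left_restriction C g x"] l ord_arrows by simp
  ultimately show ?thesis by (simp add: g_def)
qed

lemma pseudoproduct_identity: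
  assumes e: "e \<in> identities C" and x: "x \<in> arrows C"
  shows "x \<otimes> e = right_restriction C x (meet C (\<^bold>R x) e)"
proof -
  define g where "g = meet C (\<^bold>R x) e"
  have g: "g \<in> identities C" "g \<sqsubseteq> \<^bold>R x" "g \<sqsubseteq> e" using meet assms by (simp_all add: g_def)
  note r = right_restriction[OF x g(1,2)]
  have "cmp C (right_restriction C x g) g = Some (x \<otimes> e)"
    using pseudoproduct_cmp[of x e] e x g
    by (simp add: identityD left_restriction_identity flip: g_def)
  moreover have "cmp C (right_restriction C x g) g = Some (right_restriction C x g)"
    using cmp_trg[of "right_restriction C x g"] r ord_arrows by simp
  ultimately show ?thesis by (simp add: g_def)
qed

lemma identity_pseudoproduct_identity:
  "e \<in> identities C \<Longrightarrow> f \<in> identities C \<Longrightarrow> e \<otimes> f = meet C e f"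
  by (simp add: identity_pseudoproduct identityD left_restriction_identity meet)

lemma identity_pseudoproduct_le:
  assumes "e \<in> identities C" "x \<in> arrows C"
  shows "e \<otimes> x \<sqsubseteq> x" "\<^bold>D (e \<otimes> x) = meet C e (\<^bold>D x)"
  using assms left_restriction[of x "meet C e (\<^bold>D x)"] meet[of e "\<^bold>D x"]
  by (simp_all add: identity_pseudoproduct)

lemma pseudoproduct_identity_le:
  assumes "e \<in> identities C" "x \<in> arrows C"
  shows "x \<otimes> e \<sqsubseteq> x" "\<^bold>R (x \<otimes> e) = meet C (\<^bold>R x) e"
  using assms right_restriction[of x "meet C (\<^bold>R x) e"] meet[of "\<^bold>R x" e]
  by (simp_all add: pseudoproduct_identity)

text \<open>The source of \<open>a \<otimes> b\<close> is that of \<open>a|e\<close> with \<open>e = \<^bold>R a \<and> \<^bold>D b\<close>, and \<open>a|e\<close> is just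
  \<open>a \<otimes> \<^bold>D b\<close>.\<close>

lemma src_pseudoproduct:
  assumes "a \<in> arrows C" "b \<in> arrows C"
  shows "\<^bold>D (a \<otimes> b) = \<^bold>D (a \<otimes> \<^bold>D b)"
  using src_of_cmp[OF pseudoproduct_cmp[OF assms]] assms by (simp add: pseudoproduct_identity)

lemma trg_pseudoproduct:
  assumes "a \<in> arrows C" "b \<in> arrows C"
  shows "\<^bold>R (a \<otimes> b) = \<^bold>R (\<^bold>R a \<otimes> b)"
  using trg_of_cmp[OF pseudoproduct_cmp[OF assms]] assms by (simp add: identity_pseudoproduct)

end

locale ehresmann_ordered_category_with_OC4 = ehresmann_ordered_category +
  assumes OC4: "OC4 C"
begin

text \<open>(OC7') gives a composite above \<open>a\<close> with the source and target of \<open>a\<close>; by (OC4) it is \<open>a\<close>.\<close>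

lemma below_cmp_splits:
  assumes "a \<sqsubseteq> bc" "cmp C b c = Some bc"
  shows "\<exists>b' c'. b' \<sqsubseteq> b \<and> c' \<sqsubseteq> c \<and> cmp C b' c' = Some a"
proof -
  obtain b' c' bc' where *: "b' \<sqsubseteq> b" "c' \<sqsubseteq> c" "\<^bold>D a = \<^bold>D b'" "\<^bold>R a = \<^bold>R c'"
    "cmp C b' c' = Some bc'" "a \<sqsubseteq> bc'"
    using OC7'[OF assms(2,1)] by blast
  then have "a = bc'"
    using OC4 src_of_cmp[OF *(5)] trg_of_cmp[OF *(5)] ord_arrows[OF *(6)]
    unfolding OC4_def by auto
  with * show ?thesis by blast
qed

text \<open>The value \<open>a \<otimes> b \<otimes> c\<close> is a composite \<open>u \<circ> c'\<close> with \<open>u \<sqsubseteq> a \<otimes> b\<close>. Splitting \<open>u\<close> along a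
  factorisation of \<open>a \<otimes> b\<close> turns it into a triple composite of elements below \<open>a\<close>, \<open>b\<close> and \<open>c\<close>.\<close>

lemma pseudoproduct_left_greatest:
  assumes "a \<in> arrows C" "b \<in> arrows C" "c \<in> arrows C"
  shows "is_greatest (ord C) {x. \<exists>a' b' c'. a' \<sqsubseteq> a \<and> b' \<sqsubseteq> b \<and> c' \<sqsubseteq> c \<and>
    (\<exists>u. cmp C a' b' = Some u \<and> cmp C u c' = Some x)} (a \<otimes> b \<otimes> c)"
proof -
  obtain u c' where uc: "u \<sqsubseteq> a \<otimes> b" "c' \<sqsubseteq> c" "cmp C u c' = Some (a \<otimes> b \<otimes> c)"
    using pseudoproduct_splits[of "a \<otimes> b" c] assms by auto
  obtain a0 b0 where ab0: "a0 \<sqsubseteq> a" "b0 \<sqsubseteq> b" "cmp C a0 b0 = Some (a \<otimes> b)"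
    using pseudoproduct_splits assms by blast
  obtain a' b' where ab: "a' \<sqsubseteq> a0" "b' \<sqsubseteq> b0" "cmp C a' b' = Some u"
    using below_cmp_splits[OF uc(1) ab0(3)] by blast
  have "a' \<sqsubseteq> a" "b' \<sqsubseteq> b" using ab ab0 ord_trans by blast+
  moreover have "x \<sqsubseteq> a \<otimes> b \<otimes> c" if "a' \<sqsubseteq> a" "b' \<sqsubseteq> b" "c' \<sqsubseteq> c" "cmp C a' b' = Some u"
    "cmp C u c' = Some x" for a' b' c' u x
    using that cmp_le_pseudoproduct by blast
  ultimately show ?thesis unfolding is_greatest_def using uc ab by blast
qed

lemma pseudoproduct_right_greatest:
  assumes "a \<in> arrows C" "b \<in> arrows C" "c \<in> arrows C"
  shows "is_greatest (ord C) {x. \<exists>a' b' c'. a' \<sqsubseteq> a \<and> b' \<sqsubseteq> b \<and> c' \<sqsubseteq> c \<and>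
    (\<exists>v. cmp C b' c' = Some v \<and> cmp C a' v = Some x)} (a \<otimes> (b \<otimes> c))"
proof -
  obtain a' v where av: "a' \<sqsubseteq> a" "v \<sqsubseteq> b \<otimes> c" "cmp C a' v = Some (a \<otimes> (b \<otimes> c))"
    using pseudoproduct_splits[of a "b \<otimes> c"] assms by auto
  obtain b0 c0 where bc0: "b0 \<sqsubseteq> b" "c0 \<sqsubseteq> c" "cmp C b0 c0 = Some (b \<otimes> c)"
    using pseudoproduct_splits assms by blast
  obtain b' c' where bc: "b' \<sqsubseteq> b0" "c' \<sqsubseteq> c0" "cmp C b' c' = Some v"
    using below_cmp_splits[OF av(2) bc0(3)] by blast
  have "b' \<sqsubseteq> b" "c' \<sqsubseteq> c" using bc bc0 ord_trans by blast+
  moreover have "x \<sqsubseteq> a \<otimes> (b \<otimes> c)" if "a' \<sqsubseteq> a" "b' \<sqsubseteq> b" "c' \<sqsubseteq> c" "cmp C b' c' = Some v"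
    "cmp C a' v = Some x" for a' b' c' v x
    using that cmp_le_pseudoproduct by blast
  ultimately show ?thesis unfolding is_greatest_def using av bc by blast
qed

lemma pseudoproduct_assoc:
  "a \<in> arrows C \<Longrightarrow> b \<in> arrows C \<Longrightarrow> c \<in> arrows C \<Longrightarrow> a \<otimes> b \<otimes> c = a \<otimes> (b \<otimes> c)"
  by (rule greatest_unique[OF antisym_ord pseudoproduct_left_greatest])
    (simp_all only: cmp_assoc_iff pseudoproduct_right_greatest)

lemma ehresmann_semigroup_of_category: "ehresmann_semigroup (semigroup_of_category C)"
proof (unfold_locales, goal_cases)
  \<comment> \<open>closure of the multiplication, and the laws for the source and the target of a product\<close>
  case 1
  then show ?case by (auto simp: semigroup_of_category_def)
next
  case (9 s t)
  then show ?case using src_pseudoproduct[of s t] by simp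
next
  case (10 s t)
  then show ?case using trg_pseudoproduct[of s t] by simp
qed (auto simp: src_closed trg_closed pseudoproduct_assoc src_cmp cmp_trg src_trg trg_src
    pseudoproduct_eq_cmp identity_pseudoproduct_identity meet identityD
    intro: meet_commute)

text \<open>If \<open>s \<sqsubseteq> t\<close>, monotonicity of \<open>\<otimes>\<close> puts \<open>s = \<^bold>D s \<otimes> (s \<otimes> \<^bold>R s)\<close> below \<open>w = \<^bold>D s \<otimes> (t \<otimes> \<^bold>R s)\<close>. Hence
  \<open>\<^bold>D s \<sqsubseteq> \<^bold>D w\<close>, while the outer factor \<open>\<^bold>D s\<close> of \<open>w\<close> forces \<open>\<^bold>D w \<sqsubseteq> \<^bold>D s\<close>; likewise for \<open>\<^bold>R\<close>, and
  (OC4) applies. Conversely, multiplying by identities only decreases an element.\<close>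

lemma ord_iff_pseudoproduct:
  assumes s: "s \<in> arrows C" and t: "t \<in> arrows C"
  shows "s \<sqsubseteq> t \<longleftrightarrow> s = \<^bold>D s \<otimes> (t \<otimes> \<^bold>R s)"
proof
  assume le: "s \<sqsubseteq> t"
  have ids: "\<^bold>D s \<in> identities C" "\<^bold>R s \<in> identities C" using s by simp_all
  define w where "w = \<^bold>D s \<otimes> (t \<otimes> \<^bold>R s)"
  have w: "w \<in> arrows C" using s t by (simp add: w_def)
  have "s = \<^bold>D s \<otimes> (s \<otimes> \<^bold>R s)"
    using s by (simp add: pseudoproduct_eq_cmp src_cmp cmp_trg)
  also have "\<dots> \<sqsubseteq> w" unfolding w_def using s le by (intro pseudoproduct_mono ord_refl) simp_all
  finally have sw: "s \<sqsubseteq> w" .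
  have "\<^bold>D w \<sqsubseteq> \<^bold>D s"
    using identity_pseudoproduct_le(2)[OF ids(1), of "t \<otimes> \<^bold>R s"] meet(2)[OF ids(1)] s t
    by (simp add: w_def)
  moreover have "\<^bold>R w \<sqsubseteq> \<^bold>R s"
    using pseudoproduct_identity_le(2)[OF ids(2), of "\<^bold>D s \<otimes> t"] meet(3)[OF _ ids(2)] s t
    by (simp add: w_def pseudoproduct_assoc)
  ultimately have "\<^bold>D s = \<^bold>D w" "\<^bold>R s = \<^bold>R w"
    using src_mono[OF sw] trg_mono[OF sw] ord_antisym by blast+
  then show "s = \<^bold>D s \<otimes> (t \<otimes> \<^bold>R s)"
    using OC4 sw s w unfolding OC4_def w_def by blast
next
  assume "s = \<^bold>D s \<otimes> (t \<otimes> \<^bold>R s)"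
  moreover have "\<^bold>D s \<otimes> (t \<otimes> \<^bold>R s) \<sqsubseteq> t \<otimes> \<^bold>R s" "t \<otimes> \<^bold>R s \<sqsubseteq> t"
    using identity_pseudoproduct_le(1) pseudoproduct_identity_le(1) s t by simp_all
  ultimately show "s \<sqsubseteq> t" using ord_trans by metis
qed

lemma le_e_semigroup_of_category: "le_e (semigroup_of_category C) = ord C"
proof -
  interpret T: ehresmann_semigroup "semigroup_of_category C"
    by (rule ehresmann_semigroup_of_category)
  have "(s, t) \<in> le_e (semigroup_of_category C) \<longleftrightarrow> s \<sqsubseteq> t" for s t
    using ord_iff_pseudoproduct[of s t] ord_arrows[of s t] T.le_e_iff[of s t] by auto
  then show ?thesis by auto
qed

lemma de_Barros_semigroup_of_category: "de_Barros_semigroup (semigroup_of_category C)"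
proof -
  interpret T: ehresmann_semigroup "semigroup_of_category C"
    by (rule ehresmann_semigroup_of_category)
  show ?thesis
  proof
    fix a b c d
    assume "(a, b) \<in> le_e (semigroup_of_category C)" "(c, d) \<in> le_e (semigroup_of_category C)"
    then have "a \<sqsubseteq> b" "c \<sqsubseteq> d" by (simp_all add: le_e_semigroup_of_category)
    then show "(mul (semigroup_of_category C) a c, mul (semigroup_of_category C) b d)
      \<in> le_e (semigroup_of_category C)"
      using pseudoproduct_mono ord_arrows by (simp add: le_e_semigroup_of_category)
  qed
qed

lemma category_of_semigroup_of_category: "category_of_semigroup (semigroup_of_category C) = C"
proof -
  let ?C = "category_of_semigroup (semigroup_of_category C)"
  have "cmp ?C x y = cmp C x y" for x y
  proof (cases "cmp C x y")
    case None
    then show ?thesis using cmp_defined_iff[of x y]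
      by (auto simp: category_of_semigroup_def)
  next
    case (Some z)
    then show ?thesis using cmp_src_trg[of x y z] cmp_closed[of x y z] pseudoproduct_eq_cmp
      by (auto simp: category_of_semigroup_def)
  qed
  then have "cmp ?C = cmp C" by blast
  then show ?thesis
    by (intro ordered_category_struct.equality) (simp_all add: le_e_semigroup_of_category)
qed

end

section \<open>The correspondence of objects and arrows\<close>

text \<open>Here \<open>e = \<R> s \<cdot> \<D> t\<close>, and the restrictions in the pseudoproduct are \<open>s \<cdot> e\<close> and \<open>e \<cdot> t\<close>; the
  factors of \<open>e\<close> are absorbed by \<open>s\<close> and \<open>t\<close>.\<close>

lemma (in de_Barros_semigroup) pseudoproduct_category_of_semigroup:
  assumes s: "s \<in> elems S" and t: "t \<in> elems S"
  shows "pseudoproduct (category_of_semigroup S) s t = s \<cdot> t"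
proof -
  let ?C = "category_of_semigroup S"
  interpret C: ehresmann_ordered_category ?C by (rule ehresmann_ordered_category_of_semigroup)
  define e where "e = \<R> s \<cdot> \<D> t"
  have e: "e \<in> projections S" using s t by (simp add: e_def)
  then have e': "e \<in> elems S" "e \<cdot> e = e" by (rule projection)+
  have "cmp ?C (s \<cdot> e) (e \<cdot> t) = Some (pseudoproduct ?C s t)"
    using C.pseudoproduct_cmp[of s t] s t e
    by (simp add: meet_eq_mul left_restriction_eq_mul right_restriction_eq_mul flip: e_def)
  then have "pseudoproduct ?C s t = (s \<cdot> e) \<cdot> (e \<cdot> t)"
    by (simp add: cmp_category_of_semigroup)
  also have "\<dots> = s \<cdot> ((e \<cdot> e) \<cdot> t)" using s t e'(1) by (simp add: mul_assoc)
  also have "\<dots> = (s \<cdot> \<R> s) \<cdot> (\<D> t \<cdot> t)" unfolding e'(2) using s t by (simp add: e_def mul_assoc)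
  also have "\<dots> = s \<cdot> t" using s t by (simp add: D_mul mul_R)
  finally show ?thesis .
qed

lemma (in de_Barros_semigroup) semigroup_of_category_of_semigroup:
  "semigroup_of_category (category_of_semigroup S) = S"
proof -
  let ?T = "semigroup_of_category (category_of_semigroup S)"
  have "mul ?T s t = s \<cdot> t" for s t
  proof (cases "s \<in> elems S \<and> t \<in> elems S")
    case True
    then show ?thesis by (simp add: pseudoproduct_category_of_semigroup)
  next
    case False
    have "mul S s \<in> extensional (elems S)" if "s \<in> elems S"
      using mul_closed that by (auto simp: PiE_def)
    moreover have "mul S \<in> extensional (elems S)" using mul_closed by (auto simp: PiE_def)
    ultimately show ?thesis using False
      by (auto simp: semigroup_of_category_def extensional_def)
  qed
  then have "mul ?T = mul S" by blast
  then show ?thesis by (intro biunary_semigroup.equality) simp_all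
qed

lemma bij_category_of_semigroup:
  "bij_betw category_of_semigroup {S. de_Barros_semigroup S}
    {C. ehresmann_ordered_category C \<and> OC4 C}"
proof (rule bij_betw_byWitness[where f' = semigroup_of_category])
  show "\<forall>S\<in>{S. de_Barros_semigroup S}. semigroup_of_category (category_of_semigroup S) = S"
    by (simp add: de_Barros_semigroup.semigroup_of_category_of_semigroup)
  show "\<forall>C\<in>{C. ehresmann_ordered_category C \<and> OC4 C}.
      category_of_semigroup (semigroup_of_category C) = C"
    by (auto intro!: ehresmann_ordered_category_with_OC4.category_of_semigroup_of_category
        simp: ehresmann_ordered_category_with_OC4_def ehresmann_ordered_category_with_OC4_axioms_def)
  show "category_of_semigroup ` {S. de_Barros_semigroup S}
      \<subseteq> {C. ehresmann_ordered_category C \<and> OC4 C}"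
    by (auto simp: de_Barros_semigroup.ehresmann_ordered_category_of_semigroup
        de_Barros_semigroup.axioms(1) ehresmann_semigroup.OC4_category_of_semigroup)
  show "semigroup_of_category ` {C. ehresmann_ordered_category C \<and> OC4 C}
      \<subseteq> {S. de_Barros_semigroup S}"
    by (auto intro!: ehresmann_ordered_category_with_OC4.de_Barros_semigroup_of_category
        simp: ehresmann_ordered_category_with_OC4_def ehresmann_ordered_category_with_OC4_axioms_def)
qed

lemma ehresmann_ordered_functor_pseudoproduct:
  assumes A: "ehresmann_ordered_category A" and F: "F \<in> ehresmann_ordered_functor A B"
    and a: "a \<in> arrows A" and b: "b \<in> arrows A"
  shows "F (pseudoproduct A a b) = pseudoproduct B (F a) (F b)"
proof -
  interpret A: ehresmann_ordered_category A by (rule A)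
  define e where "e = meet A (trg A a) (src A b)"
  have e: "e \<in> identities A" "e \<sqsubseteq>\<^bsub>A\<^esub> trg A a" "e \<sqsubseteq>\<^bsub>A\<^esub> src A b"
    using A.meet a b by (simp_all add: e_def)
  have "cmp A (right_restriction A a e) (left_restriction A e b) = Some (pseudoproduct A a b)"
    using A.pseudoproduct_cmp a b by (simp add: e_def)
  then have "cmp B (F (right_restriction A a e)) (F (left_restriction A e b))
      = Some (F (pseudoproduct A a b))"
    using F by (auto simp: ehresmann_ordered_functor_def is_functor_def)
  moreover have "F (right_restriction A a e) = right_restriction B (F a) (F e)"
    "F (left_restriction A e b) = left_restriction B (F e) (F b)"
    using F e a b by (auto simp: ehresmann_ordered_functor_def)
  moreover have "F e = meet B (trg B (F a)) (src B (F b))"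
    using F a b by (auto simp: e_def ehresmann_ordered_functor_def is_functor_def)
  ultimately show ?thesis by (simp add: pseudoproduct_def Let_def)
qed

text \<open>Ordered functors preserve pseudoproducts, which in these categories are the products. In
  the other direction, homomorphisms preserve the equation defining \<open>\<le>\<^sub>e\<close> and all products with
  projections, which are the meets and restrictions.\<close>

lemma ehresmann_ordered_functor_eq_hom:
  assumes S: "de_Barros_semigroup S" and T: "de_Barros_semigroup T"
  shows "ehresmann_ordered_functor (category_of_semigroup S) (category_of_semigroup T)
    = ehresmann_hom S T"
proof
  interpret S: de_Barros_semigroup S by (rule S)
  interpret T: de_Barros_semigroup T by (rule T)
  let ?A = "category_of_semigroup S" and ?B = "category_of_semigroup T"
  show "ehresmann_ordered_functor ?A ?B \<subseteq> ehresmann_hom S T"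
  proof
    fix F assume F: "F \<in> ehresmann_ordered_functor ?A ?B"
    then have "F \<in> extensional (elems S)" and is_functor: "is_functor ?A ?B F"
      by (simp_all add: ehresmann_ordered_functor_def)
    then have "F \<in> elems S \<rightarrow>\<^sub>E elems T" by (auto simp: is_functor_def PiE_def)
    moreover have "F (mul S s t) = mul T (F s) (F t)" if "s \<in> elems S" "t \<in> elems S" for s t
      using ehresmann_ordered_functor_pseudoproduct[OF S.ehresmann_ordered_category_of_semigroup F,
          of s t] that PiE_mem[OF calculation]
      by (simp add: S.pseudoproduct_category_of_semigroup T.pseudoproduct_category_of_semigroup)
    ultimately show "F \<in> ehresmann_hom S T"
      using is_functor by (simp add: ehresmann_hom_def is_functor_def)
  qed
  show "ehresmann_hom S T \<subseteq> ehresmann_ordered_functor ?A ?B"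
  proof
    fix F assume F: "F \<in> ehresmann_hom S T"
    then have ext: "F \<in> elems S \<rightarrow>\<^sub>E elems T"
      and mul: "\<And>s t. s \<in> elems S \<Longrightarrow> t \<in> elems S \<Longrightarrow> F (mul S s t) = mul T (F s) (F t)"
      and D: "\<And>s. s \<in> elems S \<Longrightarrow> F (dm S s) = dm T (F s)"
      and R: "\<And>s. s \<in> elems S \<Longrightarrow> F (rg S s) = rg T (F s)"
      by (simp_all add: ehresmann_hom_def)
    have cl: "F s \<in> elems T" if "s \<in> elems S" for s using ext that by auto
    have proj: "e \<in> elems S" "F e \<in> projections T" if "e \<in> projections S" for e
      using that D[of e] cl[of e] by (auto simp: S.projections_iff T.projections_iff)
    have "is_functor ?A ?B F"
      by (auto simp: is_functor_def cmp_category_of_semigroup cl D R mul)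
        (metis D R)
    moreover have "(F s, F t) \<in> le_e T" if "(s, t) \<in> le_e S" for s t
    proof -
      have st: "s \<in> elems S" "t \<in> elems S" and "s = mul S (dm S s) (mul S t (rg S s))"
        using that S.le_e_iff by blast+
      then have "F s = F (mul S (dm S s) (mul S t (rg S s)))" by simp
      then show ?thesis using st by (simp add: T.le_e_iff cl mul D R)
    qed
    ultimately show "F \<in> ehresmann_ordered_functor ?A ?B"
      using ext
      by (auto simp: ehresmann_ordered_functor_def PiE_def mul cl proj S.meet_eq_mul T.meet_eq_mul
          S.left_restriction_eq_mul T.left_restriction_eq_mul
          S.right_restriction_eq_mul T.right_restriction_eq_mul)
  qed
qed

lemma ehresmann_hom_id:
  "ehresmann_semigroup S \<Longrightarrow> (\<lambda>x\<in>elems S. x) \<in> ehresmann_hom S S"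
  by (simp add: ehresmann_hom_def ehresmann_semigroup.closed)

lemma ehresmann_hom_compose:
  assumes "ehresmann_semigroup S" "f \<in> ehresmann_hom S T" "g \<in> ehresmann_hom T V"
  shows "compose (elems S) g f \<in> ehresmann_hom S V"
  using assms unfolding ehresmann_hom_def
  by (auto simp: compose_def PiE_iff ehresmann_semigroup.closed)

theorem corollary4p9:
  shows "\<exists>F. category_isomorphism
    (de_Barros_category ::
      ('a biunary_semigroup \<times> ('a \<Rightarrow> 'a) \<times> 'a biunary_semigroup) category_struct)
    (ehresmann_ordered_category_OC4 ::
      ('a ordered_category_struct \<times> ('a \<Rightarrow> 'a) \<times> 'a ordered_category_struct) category_struct)
    F"
proof
  show "category_isomorphism (de_Barros_category ::
      ('a biunary_semigroup \<times> ('a \<Rightarrow> 'a) \<times> 'a biunary_semigroup) category_struct)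
    (ehresmann_ordered_category_OC4 ::
      ('a ordered_category_struct \<times> ('a \<Rightarrow> 'a) \<times> 'a ordered_category_struct) category_struct)
    (\<lambda>(S, f, T). (category_of_semigroup S, f, category_of_semigroup T))"
    unfolding de_Barros_category_def ehresmann_ordered_category_OC4_def
  proof (rule concrete_category_isomorphism)
    show "bij_betw category_of_semigroup {S. de_Barros_semigroup S}
      {C. ehresmann_ordered_category C \<and> OC4 C}"
      by (rule bij_category_of_semigroup)
  qed (auto simp: ehresmann_ordered_functor_eq_hom ehresmann_hom_id ehresmann_hom_compose
      de_Barros_semigroup.axioms(1), auto simp: ehresmann_hom_def)
qed

end
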